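(* Let $G$ be a graph without isolated vertices and with nonempty edge set $E(G)$, and let $\emptyset\neq D\subseteq E(G)$. Then $N_L$ is an interference of $D$ in $L(G)$ if and only if no component $G'$ of $G$ is $K_2$ or satisfies $P_4\subseteq G'\subseteq K_4$ and, for every $e\in E(G)\setminus D$, at least one neighboring edge of $e$ has a neighboring edge in $D$.
   Context: All graphs are finite and simple. $L(G)$ is the line graph of $G$; two distinct edges are neighboring (adjacent) if they share an endpoint. For $e\in E(G)$, $N_L(e)=N_{L(G)}(e)$ is the set of edges of $G$ adjacent to $e$. $N_L: E(G)\to 2^{E(G)}$ is an interference of $D$ in $L(G)$ (with respect to the complete graph on $E(G)$) if $N_L$ is injective, $N_L(e)\neq\emptyset$ for all $e\in E(G)$, and for every $e\in E(G)\setminus D$ there is $d\in D$ with $N_L(e)\cap N_L(d)\neq\emptyset$. $P_4$ is the path of order 4; $P_4\subseteq G'\subseteq K_4$ means that $G'$ is (isomorphic to) a subgraph of $K_4$ that contains a (not necessarily induced) subgraph isomorphic to $P_4$. *)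

theory Defs
  imports "Graph_Theory.Graph_Theory"
begin

text \<open>
  As in Graph_Theory, a finite simple graph is a symmetric loop-free digraph (\<open>pair_graph\<close>).
  Both arcs between adjacent \<open>u\<close> and \<open>v\<close> represent the one undirected edge \<open>{u, v}\<close>.
  In a symmetric digraph the strongly connected components (\<open>sccs\<close>), which are
  induced subgraphs, are the components of the graph.
\<close>

definition uedges :: "'a pair_pre_digraph \<Rightarrow> 'a set set" where
  "uedges G = {{u, v} | u v. (u, v) \<in> parcs G}"

definition neighborhood :: "'a pair_pre_digraph \<Rightarrow> 'a \<Rightarrow> 'a set" where
  "neighborhood G v = {w. (v, w) \<in> parcs G}"

definition line_graph :: "'a pair_pre_digraph \<Rightarrow> 'a set pair_pre_digraph" where
  "line_graph G = \<lparr> pverts = uedges G,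
     parcs = {(e, f). e \<in> uedges G \<and> f \<in> uedges G \<and> e \<noteq> f \<and> e \<inter> f \<noteq> {}} \<rparr>"

text \<open>
  Interference of \<open>D\<close> in a graph \<open>H\<close> with respect to the complete graph on the vertices of \<open>H\<close>:
  completeness is why \<open>d\<close> below ranges over all of \<open>D\<close>, with no adjacency condition on \<open>v\<close> and \<open>d\<close>.
\<close>
definition interference :: "('a \<Rightarrow> 'a set) \<Rightarrow> 'a set \<Rightarrow> 'a pair_pre_digraph \<Rightarrow> bool" where
  "interference f D H \<longleftrightarrow>
     f \<in> pverts H \<rightarrow> Pow (pverts H) \<and>
     inj_on f (pverts H) \<and>
     (\<forall>v\<in>pverts H. f v \<noteq> {}) \<and>
     (\<forall>v\<in>pverts H - D. \<exists>d\<in>D. f v \<inter> f d \<noteq> {})"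

text \<open>The path of order \<open>n\<close>.\<close>
definition path_graph :: "nat \<Rightarrow> nat pair_pre_digraph" where
  "path_graph n = \<lparr> pverts = {..<n},
     parcs = {(i, j). i < n \<and> j < n \<and> (j = Suc i \<or> i = Suc j)} \<rparr>"

text \<open>Isomorphic to a not necessarily induced subgraph.\<close>
definition subgraph_up_to_iso :: "('a, 'b) pre_digraph \<Rightarrow> ('c, 'd) pre_digraph \<Rightarrow> bool" where
  "subgraph_up_to_iso H G \<longleftrightarrow> (\<exists>H'. subgraph H' G \<and> digraph_iso H H')"

text \<open>
  \<open>P\<^sub>4 \<subseteq> C \<subseteq> K\<^sub>4\<close>. The library's complete graph is a predicate on graphs, so a \<open>K\<^sub>4\<close> is quantified
  over; the choice of vertex type for it is immaterial.
\<close>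
definition between_P4_K4 :: "('a, 'b) pre_digraph \<Rightarrow> bool" where
  "between_P4_K4 C \<longleftrightarrow>
     subgraph_up_to_iso (with_proj (path_graph 4)) C \<and>
     (\<exists>K :: (nat, nat \<times> nat) pre_digraph. K\<^bsub>4\<^esub> K \<and> subgraph_up_to_iso C K)"

lemma pair_graph_path_graph: "pair_graph (path_graph n)"
proof -
  have "finite (parcs (path_graph n))"
    by (rule finite_subset[of _ "{..<n} \<times> {..<n}"]) (auto simp: path_graph_def)
  then show ?thesis
    by unfold_locales
      (auto simp: path_graph_def symmetric_def arcs_ends_def arc_to_ends_def sym_def)
qed

lemma pair_graph_line_graph:
  assumes "pair_graph G" shows "pair_graph (line_graph G)"
proof -
  interpret pair_graph G by fact
  have "uedges G = (\<lambda>(u, v). {u, v}) ` parcs G"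
    by (auto simp: uedges_def)
  then have fin: "finite (uedges G)"
    using pair_finite_arcs by simp
  moreover have "finite (parcs (line_graph G))"
    by (rule finite_subset[of _ "uedges G \<times> uedges G"]) (auto simp: line_graph_def fin)
  ultimately show ?thesis
    by unfold_locales
      (auto simp: line_graph_def symmetric_def arcs_ends_def arc_to_ends_def sym_def)
qed

end

theory Submission
  imports Defs
begin

text \<open>
  Write \<open>N\<close> for the neighborhood function of the line graph. Since \<open>N e\<close> meets \<open>N d\<close> exactly if a
  neighbor of \<open>e\<close> has \<open>d\<close> as a neighbor, the domination clause of interference is the second
  conjunct of the right-hand side. It remains to see that \<open>N\<close> is injective with nonempty values iff
  no component is \<open>K\<^sub>2\<close> or lies between \<open>P\<^sub>4\<close> and \<open>K\<^sub>4\<close>.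

  An edge \<open>uv\<close> with \<open>N uv = {}\<close> is a component isomorphic to \<open>K\<^sub>2\<close>
  (\<open>empty_line_neighborhood_iff_K2\<close>). Suppose that \<open>e \<noteq> f\<close> and \<open>N e = N f \<noteq> {}\<close>
  (\<open>inj_line_neighborhood_iff\<close>). The edges \<open>e\<close> and \<open>f\<close> do not meet, for otherwise
  \<open>e \<in> N f = N e\<close>. An edge that meets \<open>e \<union> f\<close> meets both \<open>e\<close> and \<open>f\<close> or is one of them, so the
  four vertices of \<open>e \<union> f\<close> are closed under adjacency; a common neighbor links \<open>e\<close> to \<open>f\<close> and
  yields a \<open>P\<^sub>4\<close> that spans the component \<open>e \<union> f\<close>. Conversely, if \<open>a, b, c, d\<close> are all vertices
  of a component and \<open>ab\<close>, \<open>cd\<close> are edges, these two edges do not meet and every further edge of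
  the component joins \<open>{a, b}\<close> to \<open>{c, d}\<close>; so both have exactly the further edges as neighbors.

  To use this, isomorphism with a subgraph is first translated into the existence of an injective
  homomorphism (\<open>subgraph_up_to_iso_iff\<close>); being contained in \<open>K\<^sub>n\<close> then means having at most
  \<open>n\<close> vertices, and containing \<open>P\<^sub>4\<close> means having a path on four vertices.
\<close>

section \<open>Subgraphs up to isomorphism\<close>

text \<open>
  An embedding determines the vertices of the subgraph; its arcs are chosen among the arcs of \<open>G\<close>
  with the right ends. Without parallel arcs in \<open>H\<close>, distinct arcs have distinct ends, so this
  choice is injective.
\<close>
lemma subgraph_up_to_iso_iff:
  assumes "nomulti_digraph H" and "wf_digraph G"
  shows "subgraph_up_to_iso H G \<longleftrightarrow>
    (\<exists>\<phi>. inj_on \<phi> (verts H) \<and> \<phi> ` verts H \<subseteq> verts G \<and>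
      (\<forall>(u, v) \<in> arcs_ends H. (\<phi> u, \<phi> v) \<in> arcs_ends G))"
    (is "?L \<longleftrightarrow> ?R")
proof
  assume ?L
  then obtain H' h where sub: "subgraph H' G" and iso: "pre_digraph.digraph_isomorphism H h"
      and H': "H' = app_iso h H"
    unfolding subgraph_up_to_iso_def digraph_iso_def by blast
  have "iso_verts h ` verts H \<subseteq> verts G"
    using subgraph_imp_subverts[OF sub] by (simp add: H')
  moreover have "(iso_verts h u, iso_verts h v) \<in> arcs_ends G" if uv: "(u, v) \<in> arcs_ends H" for u v
  proof -
    obtain a where a: "a \<in> arcs H" "tail H a = u" "head H a = v"
      using uv by (auto simp: arcs_ends_conv)
    then have "(iso_verts h u, iso_verts h v) \<in> arcs_ends H'"
      using iso
      by (auto simp: H' arcs_ends_conv pre_digraph.digraph_isomorphism_def image_iff intro!: bexI[of _ a])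
    then show ?thesis
      using arcs_ends_mono[OF sub] by blast
  qed
  ultimately show ?R
    using iso by (auto simp: pre_digraph.digraph_isomorphism_def intro!: exI[of _ "iso_verts h"])
next
  interpret H: nomulti_digraph H by fact
  interpret G: wf_digraph G by fact
  assume ?R
  then obtain \<phi> where inj: "inj_on \<phi> (verts H)" and verts: "\<phi> ` verts H \<subseteq> verts G"
      and hom: "\<forall>(u, v) \<in> arcs_ends H. (\<phi> u, \<phi> v) \<in> arcs_ends G"
    by blast
  have "\<exists>b. b \<in> arcs G \<and> tail G b = \<phi> (tail H a) \<and> head G b = \<phi> (head H a)"
    if "a \<in> arcs H" for a
    using bspec[OF hom, of "(tail H a, head H a)"] that by (auto simp: arcs_ends_conv)
  then obtain \<psi> where \<psi>: "\<And>a. a \<in> arcs H \<Longrightarrow>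
      \<psi> a \<in> arcs G \<and> tail G (\<psi> a) = \<phi> (tail H a) \<and> head G (\<psi> a) = \<phi> (head H a)"
    by metis
  have "inj_on \<psi> (arcs H)"
  proof (rule inj_onI)
    fix a b assume ab: "a \<in> arcs H" "b \<in> arcs H" "\<psi> a = \<psi> b"
    then have "\<phi> (tail H a) = \<phi> (tail H b)" "\<phi> (head H a) = \<phi> (head H b)"
      using \<psi> by metis+
    then show "a = b"
      using ab inj by (auto simp: arc_to_ends_def inj_on_eq_iff intro: H.no_multi_arcs)
  qed
  define h where
    "h = \<lparr> iso_verts = \<phi>, iso_arcs = \<psi>, iso_head = head G, iso_tail = tail G \<rparr>"
  have iso: "H.digraph_isomorphism h"
    unfolding H.digraph_isomorphism_def
    using inj \<open>inj_on \<psi> (arcs H)\<close> \<psi> H.wf_digraph by (simp add: h_def)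
  have "subgraph (app_iso h H) G"
  proof (rule subgraphI)
    show "wf_digraph (app_iso h H)"
      using iso by (rule H.wf_digraphI_app_iso)
  qed (use verts \<psi> assms in \<open>auto simp: h_def compatible_def\<close>)
  then show ?L
    unfolding subgraph_up_to_iso_def digraph_iso_def using iso by blast
qed

text \<open>
  Every injection of the vertices into those of \<open>K\<^sub>n\<close> is a homomorphism, as a digraph has no
  loops. So only the number of vertices matters.
\<close>
lemma subgraph_of_complete_iff:
  assumes "digraph C"
  shows "(\<exists>K :: (nat, nat \<times> nat) pre_digraph. K\<^bsub>n\<^esub> K \<and> subgraph_up_to_iso C K) \<longleftrightarrow>
    card (verts C) \<le> n"
    (is "?L \<longleftrightarrow> ?R")
proof -
  interpret C: digraph C by fact
  show ?thesis
  proof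
    assume ?L
    then obtain K :: "(nat, nat \<times> nat) pre_digraph"
      where K: "K\<^bsub>n\<^esub> K" and sub: "subgraph_up_to_iso C K" by blast
    interpret K: graph K using K by (simp add: complete_digraph_def)
    obtain \<phi> where "inj_on \<phi> (verts C)" "\<phi> ` verts C \<subseteq> verts K"
      using sub subgraph_up_to_iso_iff[OF C.nomulti_digraph K.wf_digraph] by blast
    then have "card (verts C) \<le> card (verts K)"
      by (rule card_inj_on_le) simp
    then show ?R
      using K by (simp add: complete_digraph_def)
  next
    assume card: ?R
    define K :: "nat pair_pre_digraph" where
      "K = \<lparr> pverts = {..<n}, parcs = {(u, v). (u, v) \<in> {..<n} \<times> {..<n} \<and> u \<noteq> v} \<rparr>"
    have K: "K\<^bsub>n\<^esub> (with_proj K)"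
      unfolding complete_digraph_pair_def by (simp add: K_def)
    then interpret K: graph "with_proj K" by (simp add: complete_digraph_def)
    obtain \<phi> where \<phi>: "inj_on \<phi> (verts C)" "\<phi> ` verts C \<subseteq> {..<n}"
      using card by (metis C.finite_verts card_lessThan finite_lessThan card_le_inj)
    have "(\<phi> u, \<phi> v) \<in> arcs_ends (with_proj K)" if "(u, v) \<in> arcs_ends C" for u v
    proof -
      have "u \<in> verts C" "v \<in> verts C" "u \<noteq> v"
        using that C.adj_in_verts C.adj_not_same by blast+
      then show ?thesis
        using \<phi> by (auto simp: K_def inj_on_eq_iff)
    qed
    then have "subgraph_up_to_iso C (with_proj K)"
      unfolding subgraph_up_to_iso_iff[OF C.nomulti_digraph K.wf_digraph]
      using \<phi> by (auto simp: K_def)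
    with K show ?L by blast
  qed
qed

lemma contains_P4_iff:
  assumes "graph C"
  shows "subgraph_up_to_iso (with_proj (path_graph 4)) C \<longleftrightarrow>
    (\<exists>a b c d. distinct [a, b, c, d] \<and> a \<rightarrow>\<^bsub>C\<^esub> b \<and> b \<rightarrow>\<^bsub>C\<^esub> c \<and> c \<rightarrow>\<^bsub>C\<^esub> d)"
    (is "_ \<longleftrightarrow> ?R")
proof -
  interpret C: graph C by fact
  interpret P: pair_graph "path_graph 4" by (rule pair_graph_path_graph)
  have verts: "pverts (path_graph 4) = {0, 1, 2, 3}"
    by (auto simp: path_graph_def)
  have arcs: "parcs (path_graph 4) = {(0, 1), (1, 2), (2, 3), (1, 0), (2, 1), (3, 2)}"
    by (auto simp: path_graph_def)
  have "subgraph_up_to_iso (with_proj (path_graph 4)) C \<longleftrightarrow>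
      (\<exists>\<phi>. inj_on \<phi> {0, 1, 2, 3 :: nat} \<and> \<phi> ` {0, 1, 2, 3} \<subseteq> verts C \<and>
        (\<forall>(u, v) \<in> {(0, 1), (1, 2), (2, 3), (1, 0), (2, 1), (3, 2)}. \<phi> u \<rightarrow>\<^bsub>C\<^esub> \<phi> v))"
    unfolding subgraph_up_to_iso_iff[OF P.nomulti_digraph C.wf_digraph]
    by (simp only: with_proj_simps verts arcs)
  also have "\<dots> \<longleftrightarrow> ?R"
  proof
    assume ?R
    then obtain a b c d where abcd: "distinct [a, b, c, d]" "a \<rightarrow>\<^bsub>C\<^esub> b" "b \<rightarrow>\<^bsub>C\<^esub> c" "c \<rightarrow>\<^bsub>C\<^esub> d"
      by blast
    let ?\<phi> = "\<lambda>i :: nat. [a, b, c, d] ! i"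
    show "\<exists>\<phi>. inj_on \<phi> {0, 1, 2, 3 :: nat} \<and> \<phi> ` {0, 1, 2, 3} \<subseteq> verts C \<and>
        (\<forall>(u, v) \<in> {(0, 1), (1, 2), (2, 3), (1, 0), (2, 1), (3, 2)}. \<phi> u \<rightarrow>\<^bsub>C\<^esub> \<phi> v)"
      by (rule exI[of _ ?\<phi>])
        (use abcd in \<open>auto simp: C.graph_symmetric dest: C.adj_in_verts\<close>)
  next
    assume "\<exists>\<phi>. inj_on \<phi> {0, 1, 2, 3 :: nat} \<and> \<phi> ` {0, 1, 2, 3} \<subseteq> verts C \<and>
        (\<forall>(u, v) \<in> {(0, 1), (1, 2), (2, 3), (1, 0), (2, 1), (3, 2)}. \<phi> u \<rightarrow>\<^bsub>C\<^esub> \<phi> v)"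
    then obtain \<phi> :: "nat \<Rightarrow> 'a" where "inj_on \<phi> {0, 1, 2, 3}"
      and "\<phi> 0 \<rightarrow>\<^bsub>C\<^esub> \<phi> 1" "\<phi> 1 \<rightarrow>\<^bsub>C\<^esub> \<phi> 2" "\<phi> 2 \<rightarrow>\<^bsub>C\<^esub> \<phi> 3"
      by auto
    moreover from this have "distinct [\<phi> 0, \<phi> 1, \<phi> 2, \<phi> 3]"
      by (auto simp: inj_on_def)
    ultimately show ?R by blast
  qed
  finally show ?thesis .
qed

text \<open>
  The bound from \<open>K\<^sub>4\<close> leaves no vertex outside the path, whence the path spans \<open>C\<close>.
\<close>
lemma between_P4_K4_iff:
  assumes "graph C"
  shows "between_P4_K4 C \<longleftrightarrow> (\<exists>a b c d. verts C = {a, b, c, d} \<and> distinct [a, b, c, d] \<and>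
    a \<rightarrow>\<^bsub>C\<^esub> b \<and> b \<rightarrow>\<^bsub>C\<^esub> c \<and> c \<rightarrow>\<^bsub>C\<^esub> d)"
    (is "_ \<longleftrightarrow> ?R")
proof -
  interpret C: graph C by fact
  have "between_P4_K4 C \<longleftrightarrow> card (verts C) \<le> 4 \<and>
      (\<exists>a b c d. distinct [a, b, c, d] \<and> a \<rightarrow>\<^bsub>C\<^esub> b \<and> b \<rightarrow>\<^bsub>C\<^esub> c \<and> c \<rightarrow>\<^bsub>C\<^esub> d)"
    unfolding between_P4_K4_def subgraph_of_complete_iff[OF C.digraph_axioms]
      contains_P4_iff[OF assms] by blast
  also have "\<dots> \<longleftrightarrow> ?R"
  proof
    assume "card (verts C) \<le> 4 \<and>
      (\<exists>a b c d. distinct [a, b, c, d] \<and> a \<rightarrow>\<^bsub>C\<^esub> b \<and> b \<rightarrow>\<^bsub>C\<^esub> c \<and> c \<rightarrow>\<^bsub>C\<^esub> d)"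
    then obtain a b c d where card: "card (verts C) \<le> 4"
      and abcd: "distinct [a, b, c, d]" "a \<rightarrow>\<^bsub>C\<^esub> b" "b \<rightarrow>\<^bsub>C\<^esub> c" "c \<rightarrow>\<^bsub>C\<^esub> d"
      by blast
    have "{a, b, c, d} \<subseteq> verts C"
      using abcd by (auto dest: C.adj_in_verts)
    moreover have "card {a, b, c, d} = 4"
      using abcd by simp
    ultimately have "verts C = {a, b, c, d}"
      using card by (metis C.finite_verts card_seteq)
    with abcd show ?R by blast
  next
    assume ?R
    then obtain a b c d where abcd: "verts C = {a, b, c, d}" "distinct [a, b, c, d]"
        "a \<rightarrow>\<^bsub>C\<^esub> b" "b \<rightarrow>\<^bsub>C\<^esub> c" "c \<rightarrow>\<^bsub>C\<^esub> d"
      by blast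
    moreover have "card (verts C) \<le> 4"
      using abcd(1,2) by simp
    ultimately show "card (verts C) \<le> 4 \<and>
      (\<exists>a b c d. distinct [a, b, c, d] \<and> a \<rightarrow>\<^bsub>C\<^esub> b \<and> b \<rightarrow>\<^bsub>C\<^esub> c \<and> c \<rightarrow>\<^bsub>C\<^esub> d)"
      by blast
  qed
  finally show ?thesis .
qed

section \<open>Components as sets closed under adjacency\<close>

lemma (in sym_digraph) scc_closed_adj:
  assumes "C \<in> sccs" and "u \<in> verts C" and "u \<rightarrow> v"
  shows "v \<in> verts C"
proof (rule ccontr)
  assume "v \<notin> verts C"
  moreover have "verts C \<in> sccs_verts"
    using assms by (blast intro: in_sccs_vertsI_sccs)
  moreover have "u \<rightarrow>\<^sup>* v" "v \<rightarrow>\<^sup>* u"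
    using assms graph_symmetric by auto
  ultimately show False
    using assms unfolding in_sccs_verts_conv_reachable by blast
qed

text \<open>
  This is how components are recognized below: everything reachable from \<open>u\<close> stays inside a
  closed set, so \<open>S\<close> is the set of all vertices reachable from \<open>u\<close>.
\<close>
lemma (in sym_digraph) closed_set_is_scc:
  assumes "u \<in> S" and reach: "\<And>v. v \<in> S \<Longrightarrow> u \<rightarrow>\<^sup>* v"
    and closed: "\<And>v w. v \<in> S \<Longrightarrow> v \<rightarrow> w \<Longrightarrow> w \<in> S"
  shows "G \<restriction> S \<in> sccs"
proof -
  have "v \<in> S" if "u \<rightarrow>\<^sup>* v" for v
    using that by (induct rule: reachable_induct) (use assms in auto)
  then have "{v. u \<rightarrow>\<^sup>* v} = S"
    using reach by blast
  moreover have "u \<in> verts G"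
    using reach[OF \<open>u \<in> S\<close>] by (blast elim: reachable_in_vertsE)
  ultimately show ?thesis
    using induce_reachable_is_in_sccs[of u] by simp
qed

lemma (in graph) graph_scc:
  assumes "C \<in> sccs" shows "graph C"
proof -
  have ind: "induced_subgraph C G"
    using assms by (rule in_sccs_imp_induced)
  show ?thesis
    using digraph.graphI[OF digraphI_induced[OF ind] induced_graph_imp_symmetric[OF sym_arcs ind]] .
qed

lemma (in graph) adj_scc_iff:
  assumes "C \<in> sccs"
  shows "u \<rightarrow>\<^bsub>C\<^esub> v \<longleftrightarrow> u \<rightarrow> v \<and> u \<in> verts C \<and> v \<in> verts C"
proof -
  have "induced_subgraph C G"
    using assms by (rule in_sccs_imp_induced)
  then have "tail C = tail G" "head C = head G"
      "arcs C = {e \<in> arcs G. tail G e \<in> verts C \<and> head G e \<in> verts C}"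
    by (auto simp: induced_subgraph_def subgraph_def compatible_def)
  then show ?thesis
    by (auto simp: arcs_ends_conv)
qed

section \<open>Neighborhoods in the line graph\<close>

lemma neighborhood_line_graph:
  assumes "e \<in> uedges G"
  shows "neighborhood (line_graph G) e = {f \<in> uedges G. f \<noteq> e \<and> f \<inter> e \<noteq> {}}"
  using assms by (auto simp: neighborhood_def line_graph_def)

context pair_graph
begin

lemma uedgesE:
  assumes "e \<in> uedges G"
  obtains u v where "e = {u, v}" "(u, v) \<in> parcs G" "u \<noteq> v"
  using assms by (auto simp: uedges_def dest: no_loops')

lemma uedge_endE:
  assumes "e \<in> uedges G" and "v \<in> e"
  obtains u where "e = {u, v}" "(u, v) \<in> parcs G" "u \<noteq> v"
proof -
  obtain x y where "e = {x, y}" "(x, y) \<in> parcs G" "x \<noteq> y"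
    using assms(1) by (rule uedgesE)
  then show ?thesis
    using assms(2) arcs_symmetric[of x y] that[of x] that[of y] by (auto simp: insert_commute)
qed

lemma insert_in_uedges: "(u, v) \<in> parcs G \<Longrightarrow> {u, v} \<in> uedges G"
  by (auto simp: uedges_def)

lemma uedge_within_scc:
  assumes "C \<in> sccs" and "e \<in> uedges G" and "e \<inter> verts C \<noteq> {}"
  shows "e \<subseteq> verts C"
proof -
  obtain u v where e: "e = {u, v}" "(u, v) \<in> parcs G"
    using assms(2) by (rule uedgesE)
  then show ?thesis
    using assms scc_closed_adj[OF assms(1), of u v] scc_closed_adj[OF assms(1), of v u]
      arcs_symmetric by blast
qed

text \<open>
  An edge without neighbors is the only edge at either of its ends, so its ends are a set closed
  under adjacency. Conversely, no edge leaves a component, and a \<open>K\<^sub>2\<close> has room for one edge only.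
\<close>
lemma empty_line_neighborhood_iff_K2:
  "(\<exists>e \<in> uedges G. neighborhood (line_graph G) e = {}) \<longleftrightarrow> (\<exists>C \<in> sccs. K\<^bsub>2\<^esub> C)"
proof
  assume "\<exists>e \<in> uedges G. neighborhood (line_graph G) e = {}"
  then obtain e where e: "e \<in> uedges G" "neighborhood (line_graph G) e = {}" by blast
  then obtain u v where uv: "e = {u, v}" "(u, v) \<in> parcs G" "u \<noteq> v"
    by (blast elim: uedgesE)
  have only: "f = {u, v}" if "f \<in> uedges G" "f \<inter> {u, v} \<noteq> {}" for f
  proof -
    have "f \<notin> neighborhood (line_graph G) e"
      using e(2) by simp
    then show ?thesis
      using that unfolding neighborhood_line_graph[OF e(1)] by (auto simp: uv(1))
  qed
  have scc: "with_proj G \<restriction> {u, v} \<in> sccs" (is "?C \<in> _")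
  proof (rule closed_set_is_scc[of u])
    fix x y assume xy: "x \<in> {u, v}" "(x, y) \<in> parcs G"
    have "{x, y} = {u, v}"
      by (rule only[OF insert_in_uedges]) (use xy in auto)
    then show "y \<in> {u, v}" by blast
  qed (use uv in \<open>auto dest: in_arcsD1\<close>)
  moreover have "K\<^bsub>2\<^esub> ?C"
    unfolding complete_digraph_def
  proof (intro conjI)
    show "arcs_ends ?C = {(x, y). (x, y) \<in> verts ?C \<times> verts ?C \<and> x \<noteq> y}"
      using uv arcs_symmetric[OF uv(2)] by (auto simp: adj_scc_iff[OF scc] dest: no_loops')
  qed (use graph_scc[OF scc] uv in auto)
  ultimately show "\<exists>C \<in> sccs. K\<^bsub>2\<^esub> C" by blast
next
  assume "\<exists>C \<in> sccs. K\<^bsub>2\<^esub> C"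
  then obtain C where C: "C \<in> sccs" "K\<^bsub>2\<^esub> C" by blast
  then obtain u v where uv: "verts C = {u, v}" "u \<noteq> v"
    by (auto simp: complete_digraph_def card_2_iff)
  then have "u \<rightarrow>\<^bsub>C\<^esub> v"
    using C(2) by (auto simp: complete_digraph_def)
  then have edge: "{u, v} \<in> uedges G"
    using adj_scc_iff[OF C(1)] by (auto intro: insert_in_uedges)
  have only: "f = {u, v}" if f: "f \<in> uedges G" "f \<inter> {u, v} \<noteq> {}" for f
  proof -
    have "f \<subseteq> {u, v}"
      using uedge_within_scc[OF C(1), of f] f uv by simp
    moreover obtain x y where "f = {x, y}" "x \<noteq> y"
      using f(1) by (rule uedgesE)
    ultimately show ?thesis by blast
  qed
  have "neighborhood (line_graph G) {u, v} = {}"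
    unfolding neighborhood_line_graph[OF edge]
    by (intro equals0I, elim CollectE conjE) (simp add: only)
  with edge show "\<exists>e \<in> uedges G. neighborhood (line_graph G) e = {}" by blast
qed

text \<open>
  Two distinct edges with the same neighbors are disjoint and span a component. The hypothesis
  provides a neighbor; it links the two edges to a path on four vertices. Without it, two
  components \<open>K\<^sub>2\<close> would be a counterexample: both edges have the empty neighborhood.
\<close>
lemma inj_line_neighborhood_iff:
  assumes nonempty: "\<forall>e \<in> uedges G. neighborhood (line_graph G) e \<noteq> {}"
  shows "inj_on (neighborhood (line_graph G)) (uedges G) \<longleftrightarrow> \<not> (\<exists>C \<in> sccs. between_P4_K4 C)"
proof -
  let ?N = "neighborhood (line_graph G)"
  have "\<not> inj_on ?N (uedges G)" if C: "C \<in> sccs" "between_P4_K4 C" for C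
  proof -
    obtain a b c d where verts: "verts C = {a, b, c, d}" and dist: "distinct [a, b, c, d]"
        and "a \<rightarrow>\<^bsub>C\<^esub> b" "c \<rightarrow>\<^bsub>C\<^esub> d"
      using C(2) between_P4_K4_iff[OF graph_scc[OF C(1)]] by blast
    then have edges: "{a, b} \<in> uedges G" "{c, d} \<in> uedges G"
      using adj_scc_iff[OF C(1)] by (auto intro: insert_in_uedges)
    \<comment> \<open>Either side says that \<open>f\<close> has one end in \<open>{a, b}\<close> and the other end in \<open>{c, d}\<close>.\<close>
    have twins: "f \<noteq> {a, b} \<and> f \<inter> {a, b} \<noteq> {} \<longleftrightarrow> f \<noteq> {c, d} \<and> f \<inter> {c, d} \<noteq> {}"
      if f: "f \<in> uedges G" for f
    proof -
      obtain x y where xy: "f = {x, y}" "x \<noteq> y"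
        using f by (rule uedgesE)
      show ?thesis
      proof (cases "f \<inter> verts C = {}")
        case True
        then show ?thesis using verts by blast
      next
        case False
        then have "{x, y} \<subseteq> {a, b, c, d}"
          using uedge_within_scc[OF C(1) f] verts xy by simp
        then show ?thesis
          using xy(2) dist unfolding xy(1) insert_subset insert_iff empty_iff
          by (elim conjE disjE) (auto simp: doubleton_eq_iff)
      qed
    qed
    have "?N {a, b} = ?N {c, d}"
      unfolding neighborhood_line_graph[OF edges(1)] neighborhood_line_graph[OF edges(2)]
      by (intro Collect_cong conj_cong refl twins)
    moreover have "{a, b} \<noteq> {c, d}"
      using dist by auto
    ultimately show ?thesis
      using edges by (auto simp: inj_on_def)
  qed
  moreover have "\<exists>C \<in> sccs. between_P4_K4 C" if not_inj: "\<not> inj_on ?N (uedges G)"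
  proof -
    obtain e f where e: "e \<in> uedges G" and f: "f \<in> uedges G" and "e \<noteq> f" and eq: "?N e = ?N f"
      using not_inj by (auto simp: inj_on_def)
    have N: "g \<noteq> e \<and> g \<inter> e \<noteq> {} \<longleftrightarrow> g \<noteq> f \<and> g \<inter> f \<noteq> {}" if "g \<in> uedges G" for g
    proof -
      have "g \<in> ?N e \<longleftrightarrow> g \<in> ?N f"
        using eq by simp
      then show ?thesis
        using that unfolding neighborhood_line_graph[OF e] neighborhood_line_graph[OF f] by simp
    qed
    \<comment> \<open>Otherwise \<open>e\<close> would be a neighbor of \<open>f\<close> and hence of itself.\<close>
    have disj: "e \<inter> f = {}"
      using N[OF e] \<open>e \<noteq> f\<close> by simp
    have closed: "y \<in> e \<union> f" if x: "x \<in> e \<union> f" and xy: "(x, y) \<in> parcs G" for x y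
    proof -
      consider "{x, y} = e" | "{x, y} = f" | "{x, y} \<inter> e \<noteq> {}" "{x, y} \<inter> f \<noteq> {}"
        using N[OF insert_in_uedges[OF xy]] x by blast
      then show ?thesis
        using x disj by cases auto
    qed
    obtain g where "g \<in> ?N e"
      using nonempty e by blast
    then have g: "g \<in> uedges G" "g \<noteq> e" "g \<inter> e \<noteq> {}"
      unfolding neighborhood_line_graph[OF e] by simp_all
    then have "g \<inter> f \<noteq> {}"
      using N[of g] by simp
    obtain x y where xy: "g = {x, y}" "(x, y) \<in> parcs G"
      using g(1) by (rule uedgesE)
    \<comment> \<open>The common neighbor \<open>g\<close> is the middle edge \<open>bc\<close> of the path \<open>a, b, c, d\<close>.\<close>
    obtain b c where bc: "b \<in> e" "c \<in> f" "(b, c) \<in> parcs G"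
    proof -
      have "x \<in> e \<and> y \<in> f \<or> y \<in> e \<and> x \<in> f"
        using g(3) \<open>g \<inter> f \<noteq> {}\<close> disj unfolding xy(1) by blast
      then show ?thesis
        using that xy(2) arcs_symmetric[OF xy(2)] by blast
    qed
    obtain a where a: "e = {a, b}" "(a, b) \<in> parcs G" "a \<noteq> b"
      using e bc(1) by (rule uedge_endE)
    obtain d where d: "f = {d, c}" "(d, c) \<in> parcs G" "d \<noteq> c"
      using f bc(2) by (rule uedge_endE)
    have scc: "with_proj G \<restriction> (e \<union> f) \<in> sccs" (is "?C \<in> _")
    proof (rule closed_set_is_scc[of a])
      show "reachable (with_proj G) a v" if "v \<in> e \<union> f" for v
      proof -
        have "reachable (with_proj G) a a" "reachable (with_proj G) a b"
          using a in_arcsD1 by auto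
        moreover from this have "reachable (with_proj G) a c"
          using bc(3) reachable_adj_trans by blast
        moreover from this have "reachable (with_proj G) a d"
          using arcs_symmetric[OF d(2)] reachable_adj_trans by blast
        ultimately show ?thesis
          using that a(1) d(1) by blast
      qed
    qed (use a closed in auto)
    have "verts ?C = {a, b, c, d}" "distinct [a, b, c, d]"
      using a(1,3) d(1,3) disj by auto
    moreover have "a \<rightarrow>\<^bsub>?C\<^esub> b" "b \<rightarrow>\<^bsub>?C\<^esub> c" "c \<rightarrow>\<^bsub>?C\<^esub> d"
      unfolding adj_scc_iff[OF scc] using a bc d arcs_symmetric[OF d(2)] by auto
    ultimately have "between_P4_K4 ?C"
      unfolding between_P4_K4_iff[OF graph_scc[OF scc]] by blast
    with scc show ?thesis by blast
  qed
  ultimately show ?thesis by blast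
qed

end

theorem theorem4p20:
  fixes G :: "'a pair_pre_digraph" and D :: "'a set set"
  assumes "pair_graph G"
    and "\<forall>v\<in>pverts G. neighborhood G v \<noteq> {}"
    and "uedges G \<noteq> {}"
    and "D \<noteq> {}" and "D \<subseteq> uedges G"
  shows "interference (neighborhood (line_graph G)) D (line_graph G) \<longleftrightarrow>
    (\<forall>C \<in> pre_digraph.sccs (with_proj G). \<not> (K\<^bsub>2\<^esub> C \<or> between_P4_K4 C)) \<and>
    (\<forall>e \<in> uedges G - D. \<exists>f \<in> neighborhood (line_graph G) e.
       neighborhood (line_graph G) f \<inter> D \<noteq> {})"
proof -
  interpret pair_graph G by fact
  let ?N = "neighborhood (line_graph G)"
  have verts: "pverts (line_graph G) = uedges G"
    by (simp add: line_graph_def)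
  have range: "?N \<in> uedges G \<rightarrow> Pow (uedges G)"
    by (auto simp: neighborhood_line_graph)
  have sym: "f \<in> ?N e \<longleftrightarrow> e \<in> ?N f" for e f
    by (auto simp: neighborhood_def line_graph_def)
  \<comment> \<open>Both sides say that there is a walk \<open>e, f, d\<close> in the line graph with \<open>d \<in> D\<close>.\<close>
  have dominated: "(\<exists>d \<in> D. ?N e \<inter> ?N d \<noteq> {}) \<longleftrightarrow> (\<exists>f \<in> ?N e. ?N f \<inter> D \<noteq> {})" for e
    using sym by blast
  have "inj_on ?N (uedges G) \<and> (\<forall>e \<in> uedges G. ?N e \<noteq> {}) \<longleftrightarrow>
      (\<forall>C \<in> sccs. \<not> (K\<^bsub>2\<^esub> C \<or> between_P4_K4 C))"
    using empty_line_neighborhood_iff_K2 inj_line_neighborhood_iff by blast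
  then show ?thesis
    unfolding interference_def verts dominated using range by blast
qed

end
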